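(* Let $K:\ell^2\to H_2$ be linear and bounded and let $J:\ell^2\to\mathbb{R}\cup\{\infty\}$ be $J(u)=\sum_{k\in\mathbb{N}}|u_k|$ if $u\in\ell^1$ and $J(u)=+\infty$ otherwise. Let $u^\dagger$ be a $J$-minimizing solution of $Ku=g$, and assume: (a) $u^\dagger$ satisfies the source condition $K^*p^\dagger\in\partial J(u^\dagger)$ with source element $p^\dagger\in H_2$; (b) for $\xi=K^*p^\dagger$ and $I=\{k:\ |\xi_k|=1\}$, the quantity $\theta=\sup\{|\xi_k|:\ k\notin I\}$ is strictly smaller than one; (c) the operator $KP_I:\ell^1\to H_2$ is injective in the sense that $P_Iu\ne P_Iv$ implies $KP_Iu\ne KP_Iv$. Let $\delta_k>0$, $\delta_k\to0$, and $g_k\in H_2$ with $\|g_k-g\|\le\delta_k$, and let $\Gamma$ be the parameter choice according to Morozov's discrepancy principle with parameter $\rho>1$. Then $$\|\mathcal{R}_{\Gamma(\delta_k,g_k)}(g_k)-u^\dagger\|_{\ell^1}=\mathcal{O}(\delta_k).$$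
   Context: $H_2$ is a separable (real) Hilbert space, $H_1=\ell^2$, and $K^*$ is the adjoint of $K$. The element $g\in H_2$ is attainable: $Ku=g$ for some $u$ with $J(u)<\infty$. A $J$-minimizing solution of $Ku=g$ is a minimizer of $J(u)$ subject to $Ku=g$. The subdifferential $\partial J$ is taken in $\ell^2$. For $I\subset\mathbb{N}$, $P_I$ is the projection $(P_Iu)_k=u_k$ if $k\in I$ and $(P_Iu)_k=0$ if $k\notin I$. Augmented Lagrangian method: $\{\tau_n\}_{n\ge1}$ is a fixed sequence of positive numbers, $t_n:=\sum_{k=1}^n\tau_k$, with $t_n\to+\infty$ and $\sup_k\tau_k<\infty$. Given data $g^\delta$ and a fixed starting element $p_0^\delta=p_0\in H_2$, for $n=1,2,\dots$ $$u_n^\delta\in\operatorname{argmin}_{u\in\ell^2}\Big(\tfrac{\tau_n}{2}\|Ku-g^\delta\|^2+J(u)-\langle p_{n-1}^\delta,Ku-g^\delta\rangle\Big),\qquad p_n^\delta=p_{n-1}^\delta+\tau_n(g^\delta-Ku_n^\delta).$$ Set $\mathcal{R}_n(g^\delta):=u_n^\delta$. Morozov's discrepancy principle with $\rho>1$ is the stopping rule $\Gamma(\delta,g^\delta):=\min\{n\in\mathbb{N}, n\ge1:\ \|Ku_n^\delta-g^\delta\|<\rho\delta\}$ (this minimum exists whenever $\|g^\delta-g\|\le\delta$). *)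

theory Defs
  imports "HOL-Analysis.Analysis" "HOL-Library.Landau_Symbols"
begin

section \<open>The Hilbert space of square-summable real sequences\<close>

typedef ell2 = "{u :: nat \<Rightarrow> real. summable (\<lambda>k. (u k)\<^sup>2)}"
  morphisms nth_ell2 Abs_ell2
  by (rule exI[of _ "\<lambda>_. 0"]) simp

setup_lifting type_definition_ell2

lemma ell2_eqI: "(\<And>k. nth_ell2 u k = nth_ell2 v k) \<Longrightarrow> u = v"
  by (metis ext nth_ell2_inject)

lemma summable_ell2_square: "summable (\<lambda>k. (nth_ell2 u k)\<^sup>2)"
  using nth_ell2 by blast

lemma summable_mult_of_squares:
  fixes u v :: "nat \<Rightarrow> real"
  assumes "summable (\<lambda>k. (u k)\<^sup>2)" "summable (\<lambda>k. (v k)\<^sup>2)"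
  shows "summable (\<lambda>k. u k * v k)"
proof (rule summable_comparison_test')
  show "summable (\<lambda>k. (u k)\<^sup>2 + (v k)\<^sup>2)"
    using assms by (rule summable_add)
  show "norm (u k * v k) \<le> (u k)\<^sup>2 + (v k)\<^sup>2" if "k \<ge> 0" for k
  proof -
    have "0 \<le> (\<bar>u k\<bar> - \<bar>v k\<bar>)\<^sup>2" by simp
    then have "2 * (\<bar>u k\<bar> * \<bar>v k\<bar>) \<le> (u k)\<^sup>2 + (v k)\<^sup>2"
      by (simp add: power2_diff)
    moreover have "0 \<le> \<bar>u k\<bar> * \<bar>v k\<bar>" by simp
    ultimately show ?thesis unfolding real_norm_def abs_mult by linarith
  qed
qed

lemma summable_add_square:
  fixes u v :: "nat \<Rightarrow> real"
  assumes "summable (\<lambda>k. (u k)\<^sup>2)" "summable (\<lambda>k. (v k)\<^sup>2)"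
  shows "summable (\<lambda>k. (u k + v k)\<^sup>2)"
proof -
  have "summable (\<lambda>k. (u k)\<^sup>2 + (v k)\<^sup>2 + 2 * (u k * v k))"
    by (intro summable_add summable_mult summable_mult_of_squares assms)
  then show ?thesis by (simp add: power2_sum algebra_simps)
qed

instantiation ell2 :: real_vector
begin

lift_definition zero_ell2 :: ell2 is "\<lambda>_. 0" by simp

lift_definition plus_ell2 :: "ell2 \<Rightarrow> ell2 \<Rightarrow> ell2" is "\<lambda>u v k. u k + v k"
  by (rule summable_add_square)

lift_definition uminus_ell2 :: "ell2 \<Rightarrow> ell2" is "\<lambda>u k. - u k" by simp

lift_definition minus_ell2 :: "ell2 \<Rightarrow> ell2 \<Rightarrow> ell2" is "\<lambda>u v k. u k - v k"
  subgoal for u v using summable_add_square[of u "\<lambda>k. - v k"] by simp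
  done

lift_definition scaleR_ell2 :: "real \<Rightarrow> ell2 \<Rightarrow> ell2" is "\<lambda>c u k. c * u k"
  by (simp add: power_mult_distrib summable_mult)

instance
  by standard (transfer; simp add: algebra_simps fun_eq_iff)+

end

instantiation ell2 :: real_inner
begin

lift_definition inner_ell2 :: "ell2 \<Rightarrow> ell2 \<Rightarrow> real" is "\<lambda>u v. \<Sum>k. u k * v k" .

definition norm_ell2 :: "ell2 \<Rightarrow> real" where
  "norm_ell2 u = sqrt (inner u u)"

definition sgn_ell2 :: "ell2 \<Rightarrow> ell2" where
  "sgn_ell2 u = u /\<^sub>R norm u"

definition dist_ell2 :: "ell2 \<Rightarrow> ell2 \<Rightarrow> real" where
  "dist_ell2 u v = norm (u - v)"

definition uniformity_ell2 :: "(ell2 \<times> ell2) filter" where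
  "uniformity_ell2 = (INF e\<in>{0<..}. principal {(u, v). dist u v < e})"

definition open_ell2 :: "ell2 set \<Rightarrow> bool" where
  "open_ell2 U \<longleftrightarrow> (\<forall>u\<in>U. \<forall>\<^sub>F (u', v) in uniformity. u' = u \<longrightarrow> v \<in> U)"

instance
proof
  fix u v w :: ell2 and r :: real
  show "u \<bullet> v = v \<bullet> u"
    by transfer (simp add: mult.commute)
  show "(u + v) \<bullet> w = u \<bullet> w + v \<bullet> w"
    by transfer (simp add: distrib_right suminf_add summable_mult_of_squares)
  show "(r *\<^sub>R u) \<bullet> v = r * (u \<bullet> v)"
    by transfer (simp add: mult.assoc suminf_mult summable_mult_of_squares)
  show "0 \<le> u \<bullet> u"
    by transfer (simp add: suminf_nonneg flip: power2_eq_square)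
  show "u \<bullet> u = 0 \<longleftrightarrow> u = 0"
    by transfer (simp add: suminf_eq_zero_iff fun_eq_iff flip: power2_eq_square)
qed (simp_all add: dist_ell2_def sgn_ell2_def uniformity_ell2_def open_ell2_def norm_ell2_def)

end

lemma norm_ell2_square: "(norm u)\<^sup>2 = (\<Sum>k. (nth_ell2 u k)\<^sup>2)"
  by (simp add: power2_norm_eq_inner inner_ell2.rep_eq flip: power2_eq_square)

lemma sum_square_le_norm_ell2: "(\<Sum>k<n. (nth_ell2 u k)\<^sup>2) \<le> (norm u)\<^sup>2"
  unfolding norm_ell2_square by (rule sum_le_suminf[OF summable_ell2_square]) auto

lemma abs_nth_le_norm_ell2: "\<bar>nth_ell2 u k\<bar> \<le> norm u"
proof -
  have "(nth_ell2 u k)\<^sup>2 \<le> (\<Sum>i<Suc k. (nth_ell2 u i)\<^sup>2)"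
    by (simp add: sum_nonneg)
  also have "\<dots> \<le> (norm u)\<^sup>2" by (rule sum_square_le_norm_ell2)
  finally show ?thesis by (simp add: abs_le_square_iff[symmetric])
qed

instance ell2 :: complete_space
proof
  fix X :: "nat \<Rightarrow> ell2"
  assume X: "Cauchy X"
  have "Cauchy (\<lambda>n. nth_ell2 (X n) k)" for k
  proof (rule metric_CauchyI)
    fix e :: real assume "0 < e"
    then obtain M where M: "\<And>m n. m \<ge> M \<Longrightarrow> n \<ge> M \<Longrightarrow> dist (X m) (X n) < e"
      using X by (meson metric_CauchyD)
    have "dist (nth_ell2 (X m) k) (nth_ell2 (X n) k) < e" if "m \<ge> M" "n \<ge> M" for m n
      using abs_nth_le_norm_ell2[of "X m - X n" k] M[OF that]
      by (simp add: dist_norm minus_ell2.rep_eq)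
    then show "\<exists>M. \<forall>m\<ge>M. \<forall>n\<ge>M. dist (nth_ell2 (X m) k) (nth_ell2 (X n) k) < e" by blast
  qed
  then have "\<forall>k. \<exists>x. (\<lambda>n. nth_ell2 (X n) k) \<longlonglongrightarrow> x"
    using Cauchy_convergent unfolding convergent_def by blast
  then obtain l where l: "\<And>k. (\<lambda>n. nth_ell2 (X n) k) \<longlonglongrightarrow> l k"
    using choice[of "\<lambda>k x. (\<lambda>n. nth_ell2 (X n) k) \<longlonglongrightarrow> x"] by blast
  have tail: "\<exists>M. \<forall>n\<ge>M. summable (\<lambda>k. (nth_ell2 (X n) k - l k)\<^sup>2) \<and>
      (\<Sum>k. (nth_ell2 (X n) k - l k)\<^sup>2) \<le> e\<^sup>2" if "0 < e" for e :: real
  proof -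
    obtain M where M: "\<And>m n. m \<ge> M \<Longrightarrow> n \<ge> M \<Longrightarrow> dist (X m) (X n) < e"
      using X \<open>0 < e\<close> by (meson metric_CauchyD)
    have bound: "(\<Sum>k<N. (nth_ell2 (X n) k - l k)\<^sup>2) \<le> e\<^sup>2" if "n \<ge> M" for n N
    proof (rule LIMSEQ_le_const2)
      show "(\<lambda>m. \<Sum>k<N. (nth_ell2 (X n) k - nth_ell2 (X m) k)\<^sup>2)
          \<longlonglongrightarrow> (\<Sum>k<N. (nth_ell2 (X n) k - l k)\<^sup>2)"
        by (intro tendsto_intros l)
      have "(\<Sum>k<N. (nth_ell2 (X n) k - nth_ell2 (X m) k)\<^sup>2) \<le> e\<^sup>2" if "m \<ge> M" for m
      proof -
        have "(\<Sum>k<N. (nth_ell2 (X n) k - nth_ell2 (X m) k)\<^sup>2) \<le> (norm (X n - X m))\<^sup>2"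
          using sum_square_le_norm_ell2[of "X n - X m" N] by (simp add: minus_ell2.rep_eq)
        also have "\<dots> \<le> e\<^sup>2"
          using M[OF \<open>n \<ge> M\<close> that] by (intro power_mono) (auto simp: dist_norm)
        finally show ?thesis .
      qed
      then show "\<exists>K. \<forall>m\<ge>K. (\<Sum>k<N. (nth_ell2 (X n) k - nth_ell2 (X m) k)\<^sup>2) \<le> e\<^sup>2"
        by blast
    qed
    have "summable (\<lambda>k. (nth_ell2 (X n) k - l k)\<^sup>2)" if "n \<ge> M" for n
      using bound[OF that] by (intro summableI_nonneg_bounded) auto
    then show ?thesis
      using bound by (intro exI[of _ M]) (auto intro!: suminf_le_const)
  qed
  obtain M where M: "summable (\<lambda>k. (nth_ell2 (X M) k - l k)\<^sup>2)"
    using tail[of 1] by auto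
  have "summable (\<lambda>k. (nth_ell2 (X M) k + - (nth_ell2 (X M) k - l k))\<^sup>2)"
    by (rule summable_add_square[OF summable_ell2_square]) (use M in \<open>simp add: power2_commute\<close>)
  then have "summable (\<lambda>k. (l k)\<^sup>2)" by simp
  then obtain L where L: "nth_ell2 L = l"
    using Abs_ell2_inverse by blast
  have "X \<longlonglongrightarrow> L"
  proof (rule metric_LIMSEQ_I)
    fix r :: real assume "0 < r"
    then obtain M where M: "\<And>n. n \<ge> M \<Longrightarrow> (\<Sum>k. (nth_ell2 (X n) k - l k)\<^sup>2) \<le> (r / 2)\<^sup>2"
      using tail[of "r / 2"] by auto
    have "dist (X n) L < r" if "n \<ge> M" for n
    proof -
      have "(norm (X n - L))\<^sup>2 \<le> (r / 2)\<^sup>2"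
        using M[OF that] by (simp add: norm_ell2_square minus_ell2.rep_eq L)
      then have "norm (X n - L) \<le> r / 2"
        by (rule power2_le_imp_le) (use \<open>0 < r\<close> in simp)
      with \<open>0 < r\<close> show ?thesis by (simp add: dist_norm)
    qed
    then show "\<exists>M. \<forall>n\<ge>M. dist (X n) L < r" by blast
  qed
  then show "convergent X" by (rule convergentI)
qed

lift_definition proj_ell2 :: "nat set \<Rightarrow> ell2 \<Rightarrow> ell2" is
  "\<lambda>I u k. if k \<in> I then u k else 0"
  subgoal for I u by (rule summable_comparison_test'[where g = "\<lambda>k. (u k)\<^sup>2" and N = 0]) auto
  done

definition ell1 :: "ell2 set" where
  "ell1 = {u. summable (\<lambda>k. \<bar>nth_ell2 u k\<bar>)}"

text \<open>Meaningful only on \<^term>\<open>ell1\<close>.\<close>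

definition ell1_norm :: "ell2 \<Rightarrow> real" where
  "ell1_norm u = (\<Sum>k. \<bar>nth_ell2 u k\<bar>)"

definition ell1_functional :: "ell2 \<Rightarrow> ereal" where
  "ell1_functional u = (if u \<in> ell1 then ereal (ell1_norm u) else \<infinity>)"


section \<open>Variational notions\<close>

definition subdifferential :: "('a::real_inner \<Rightarrow> ereal) \<Rightarrow> 'a \<Rightarrow> 'a set" where
  "subdifferential J u = {\<xi>. \<forall>v. J u + ereal (\<xi> \<bullet> (v - u)) \<le> J v}"

text \<open>
  \<open>u\<close> and \<open>p\<close> are a primal and a dual sequence produced from the data \<open>f\<close>. The minimisers need
  not be unique, so this is a relation. The values \<open>u 0\<close> and \<open>\<tau> 0\<close> play no role.
\<close>

definition augmented_lagrangian ::
  "('a::real_normed_vector \<Rightarrow> 'b::real_inner) \<Rightarrow> ('a \<Rightarrow> ereal) \<Rightarrow> (nat \<Rightarrow> real) \<Rightarrow> 'b \<Rightarrow> 'b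
    \<Rightarrow> (nat \<Rightarrow> 'a) \<Rightarrow> (nat \<Rightarrow> 'b) \<Rightarrow> bool" where
  "augmented_lagrangian K J \<tau> p0 f u p \<longleftrightarrow>
     p 0 = p0 \<and>
     (\<forall>n\<ge>1.
        is_arg_min
          (\<lambda>v. ereal (\<tau> n / 2 * (norm (K v - f))\<^sup>2) + J v - ereal (p (n - 1) \<bullet> (K v - f)))
          (\<lambda>_. True) (u n) \<and>
        p n = p (n - 1) + \<tau> n *\<^sub>R (f - K (u n)))"

definition morozov ::
  "('a \<Rightarrow> 'b::real_normed_vector) \<Rightarrow> (nat \<Rightarrow> 'b \<Rightarrow> 'a) \<Rightarrow> real \<Rightarrow> real \<Rightarrow> 'b \<Rightarrow> nat" where
  "morozov K R \<rho> \<delta> f = (LEAST n. n \<ge> 1 \<and> norm (K (R n f) - f) < \<rho> * \<delta>)"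

end

(* Since J is positively homogeneous, the optimality conditions place the dual iterates p_n in
   C = {q. <q, K v> <= |v|_1 for all v} with <p_n, K u_n> = |u_n|_1, so that they form the proximal
   point method for maximising <f, q> over C. With t_n = tau_1 + ... + tau_n, r_n = |K u_n - f| and
   e_n = |p_dag - p_n|, the energy 2 t_n <f, p_dag - p_n> + t_n^2 r_n^2 + e_n^2 never exceeds e_0^2.
   As p_dag maximises <g, q> over C, the first inner product is at least - delta e_n. Hence
   r_n^2 <= e_0^2 / t_n^2 + delta^2, so the discrepancy principle stops while t_n delta is still
   bounded, and e_n <= e_0 + 2 t_n delta then bounds the dual error at the stopping index.
   Consequently the residual and the Bregman gap |u|_1 - <p_dag, K u> are O(delta) there. The gap
   dominates (1 - theta) times the l1 norm of u off I, and on the finite set I injectivity bounds the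
   remaining coordinates by the residual. *)

theory Submission
  imports Defs
begin

section \<open>Square-summable sequences and adjoints\<close>

lift_definition unit_ell2 :: "nat \<Rightarrow> ell2" is "\<lambda>j k. if k = j then 1 else 0"
  subgoal for j by (rule summable_finite[of "{j}"]) auto
  done

lemma nth_ell2_sum: "nth_ell2 (\<Sum>i\<in>A. f i) k = (\<Sum>i\<in>A. nth_ell2 (f i) k)"
  by (induction A rule: infinite_finite_induct) (simp_all add: zero_ell2.rep_eq plus_ell2.rep_eq)

lemma nth_unit_combination:
  assumes "finite A"
  shows "nth_ell2 (\<Sum>i\<in>A. c i *\<^sub>R unit_ell2 i) k = (if k \<in> A then c k else 0)"
proof -
  have "nth_ell2 (\<Sum>i\<in>A. c i *\<^sub>R unit_ell2 i) k = (\<Sum>i\<in>A. if k = i then c i else 0)"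
    unfolding nth_ell2_sum by (intro sum.cong) (simp_all add: scaleR_ell2.rep_eq unit_ell2.rep_eq)
  with assms show ?thesis by simp
qed

lemma proj_ell2_finite:
  assumes "finite A"
  shows "proj_ell2 A u = (\<Sum>k\<in>A. nth_ell2 u k *\<^sub>R unit_ell2 k)"
  by (rule ell2_eqI)
     (simp add: nth_unit_combination assms proj_ell2.rep_eq)

text \<open>The squared error is the tail of a convergent series. Density of finitely supported
  sequences lets a bounded operator be computed coordinate by coordinate.\<close>

lemma LIMSEQ_proj_ell2: "(\<lambda>n. proj_ell2 {..<n} u) \<longlonglongrightarrow> u"
proof (rule metric_LIMSEQ_I)
  fix r :: real assume "0 < r"
  then obtain N where N: "\<And>n. n \<ge> N \<Longrightarrow> norm (\<Sum>i. (nth_ell2 u (i + n))\<^sup>2) < r\<^sup>2"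
    using suminf_exist_split[OF _ summable_ell2_square, of "r\<^sup>2" u] by auto
  have "dist (proj_ell2 {..<n} u) u < r" if "n \<ge> N" for n
  proof -
    have "(norm (proj_ell2 {..<n} u - u))\<^sup>2 = (\<Sum>k. if k < n then 0 else (nth_ell2 u k)\<^sup>2)"
      unfolding norm_ell2_square
      by (intro suminf_cong) (simp add: minus_ell2.rep_eq proj_ell2.rep_eq)
    also have "\<dots> = (\<Sum>i. (nth_ell2 u (i + n))\<^sup>2)"
    proof -
      have "summable (\<lambda>k. if k < n then 0 else (nth_ell2 u k)\<^sup>2)"
        by (rule summable_comparison_test'[OF summable_ell2_square[of u], of 0]) auto
      from suminf_split_initial_segment[OF this, of n] show ?thesis by simp
    qed
    also have "\<dots> < r\<^sup>2" using N[OF that] by auto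
    finally show ?thesis
      using \<open>0 < r\<close> by (metis dist_norm less_eq_real_def power_less_imp_less_base)
  qed
  then show "\<exists>N. \<forall>n\<ge>N. dist (proj_ell2 {..<n} u) u < r" by blast
qed

lemma inner_bounded_linear_ell2:
  fixes K :: "ell2 \<Rightarrow> 'b::real_inner"
  assumes "bounded_linear K"
  shows "(\<lambda>k. nth_ell2 u k * (K (unit_ell2 k) \<bullet> q)) sums (K u \<bullet> q)"
proof -
  interpret bounded_linear K by fact
  have "(\<lambda>n. K (proj_ell2 {..<n} u) \<bullet> q) \<longlonglongrightarrow> K u \<bullet> q"
    by (intro tendsto_intros tendsto LIMSEQ_proj_ell2)
  then show ?thesis
    by (simp add: sums_def proj_ell2_finite sum scaleR inner_sum_left)
qed

text \<open>The constant \<open>adjoint\<close> is a choice among functions with the adjoint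
  property, so that property holds once one such function exists. The candidate has the coordinates
  \<open>K (unit_ell2 k) \<bullet> q\<close>.\<close>

lemma adjoint_ell2:
  fixes K :: "ell2 \<Rightarrow> 'b::real_inner"
  assumes "bounded_linear K"
  shows "adjoint K q \<bullet> u = q \<bullet> K u"
proof -
  interpret bounded_linear K by fact
  obtain B where B: "\<And>x. norm (K x) \<le> norm x * B" "B \<ge> 0"
    using nonneg_bounded by blast
  have bessel: "summable (\<lambda>k. (K (unit_ell2 k) \<bullet> q)\<^sup>2)" for q
  proof (rule summableI_nonneg_bounded)
    fix n
    \<comment> \<open>Pairing \<open>K v\<close> with \<open>q\<close> for the truncated candidate
      \<open>v\<close> returns the square of \<open>norm v\<close>, so \<open>norm v\<close> is at
      most \<open>B * norm q\<close> for every \<open>n\<close>.\<close>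
    define b where "b k = K (unit_ell2 k) \<bullet> q" for k
    define v where "v = (\<Sum>k<n. b k *\<^sub>R unit_ell2 k)"
    have nth_v: "nth_ell2 v k = (if k < n then b k else 0)" for k
      by (simp add: v_def nth_unit_combination)
    have norm_v: "(norm v)\<^sup>2 = (\<Sum>k<n. (b k)\<^sup>2)"
      unfolding norm_ell2_square nth_v
      by (subst suminf_finite[of "{..<n}"]) auto
    have "K v \<bullet> q = (norm v)\<^sup>2"
      by (simp add: norm_v) (simp add: v_def sum scaleR inner_sum_left b_def power2_eq_square)
    moreover have "K v \<bullet> q \<le> norm v * B * norm q"
      using norm_cauchy_schwarz[of "K v" q] B(1)[of v] by (meson mult_right_mono norm_ge_zero order_trans)
    ultimately have "norm v * norm v \<le> norm v * (B * norm q)"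
      by (simp add: power2_eq_square mult.assoc)
    then have "norm v \<le> B * norm q"
      by (metis B(2) mult_le_cancel_left_pos mult_nonneg_nonneg norm_ge_zero order_le_less)
    then have "(norm v)\<^sup>2 \<le> (B * norm q)\<^sup>2" by (intro power_mono) auto
    then show "(\<Sum>k<n. (K (unit_ell2 k) \<bullet> q)\<^sup>2) \<le> (B * norm q)\<^sup>2"
      by (simp add: norm_v b_def)
  qed auto
  define A where "A q = Abs_ell2 (\<lambda>k. K (unit_ell2 k) \<bullet> q)" for q
  have "nth_ell2 (A q) k = K (unit_ell2 k) \<bullet> q" for q k
    unfolding A_def by (subst Abs_ell2_inverse) (use bessel in auto)
  then have "u \<bullet> A q = K u \<bullet> q" for u q
    using inner_bounded_linear_ell2[OF assms, of u q]
    by (simp add: inner_ell2.rep_eq sums_iff)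
  then have "\<forall>x y. K x \<bullet> y = x \<bullet> A y" by simp
  then have "\<forall>x y. K x \<bullet> y = x \<bullet> adjoint K y"
    unfolding adjoint_def by (rule someI[where P = "\<lambda>f'. \<forall>x y. K x \<bullet> y = x \<bullet> f' y"])
  then show ?thesis by (simp add: inner_commute)
qed

section \<open>Absolutely summable sequences\<close>

lemma zero_in_ell1: "0 \<in> ell1"
  by (simp add: ell1_def zero_ell2.rep_eq)

lemma add_in_ell1: "u \<in> ell1 \<Longrightarrow> v \<in> ell1 \<Longrightarrow> u + v \<in> ell1"
  unfolding ell1_def mem_Collect_eq plus_ell2.rep_eq
  by (rule summable_comparison_test'[of "\<lambda>k. \<bar>nth_ell2 u k\<bar> + \<bar>nth_ell2 v k\<bar>" 0])
     (auto intro: summable_add)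

lemma scaleR_in_ell1: "u \<in> ell1 \<Longrightarrow> c *\<^sub>R u \<in> ell1"
  by (simp add: ell1_def scaleR_ell2.rep_eq abs_mult summable_mult)

lemma diff_in_ell1: "u \<in> ell1 \<Longrightarrow> v \<in> ell1 \<Longrightarrow> u - v \<in> ell1"
  using add_in_ell1[of u "(-1) *\<^sub>R v"] scaleR_in_ell1[of v "-1"] by simp

lemma proj_in_ell1: "u \<in> ell1 \<Longrightarrow> proj_ell2 A u \<in> ell1"
  unfolding ell1_def mem_Collect_eq proj_ell2.rep_eq
  by (rule summable_comparison_test'[of "\<lambda>k. \<bar>nth_ell2 u k\<bar>" 0]) auto

lemma ell1_norm_0: "ell1_norm 0 = 0"
  by (simp add: ell1_norm_def zero_ell2.rep_eq)

lemma ell1_norm_add: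
  assumes "u \<in> ell1" "v \<in> ell1"
  shows "ell1_norm (u + v) \<le> ell1_norm u + ell1_norm v"
proof -
  have "(\<Sum>k. \<bar>nth_ell2 (u + v) k\<bar>) \<le> (\<Sum>k. \<bar>nth_ell2 u k\<bar> + \<bar>nth_ell2 v k\<bar>)"
    using add_in_ell1[OF assms] assms
    by (intro suminf_le summable_add) (auto simp: plus_ell2.rep_eq ell1_def)
  then show ?thesis
    using assms by (simp add: ell1_norm_def ell1_def suminf_add)
qed

lemma ell1_norm_scaleR: "u \<in> ell1 \<Longrightarrow> ell1_norm (c *\<^sub>R u) = \<bar>c\<bar> * ell1_norm u"
  by (simp add: ell1_norm_def ell1_def scaleR_ell2.rep_eq abs_mult suminf_mult)

lemma abs_nth_le_ell1_norm:
  assumes "u \<in> ell1" shows "\<bar>nth_ell2 u k\<bar> \<le> ell1_norm u"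
  using sum_le_suminf[of "\<lambda>k. \<bar>nth_ell2 u k\<bar>" "{k}"] assms
  by (simp add: ell1_norm_def ell1_def)

lemma ell1_norm_nonneg: "u \<in> ell1 \<Longrightarrow> 0 \<le> ell1_norm u"
  using abs_nth_le_ell1_norm[of u 0] by linarith

text \<open>Each squared coordinate is at most \<open>ell1_norm u\<close> times its absolute value.
  The comparison makes the Hilbert-norm bound of \<open>K\<close> usable in l1 estimates.\<close>

lemma norm_le_ell1_norm:
  assumes "u \<in> ell1" shows "norm u \<le> ell1_norm u"
proof (rule power2_le_imp_le)
  have s: "summable (\<lambda>k. \<bar>nth_ell2 u k\<bar>)" using assms by (simp add: ell1_def)
  have "(norm u)\<^sup>2 \<le> (\<Sum>k. ell1_norm u * \<bar>nth_ell2 u k\<bar>)"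
    unfolding norm_ell2_square
  proof (intro suminf_le summable_ell2_square summable_mult s)
    show "(nth_ell2 u k)\<^sup>2 \<le> ell1_norm u * \<bar>nth_ell2 u k\<bar>" for k
      using mult_right_mono[OF abs_nth_le_ell1_norm[OF assms, of k], of "\<bar>nth_ell2 u k\<bar>"]
      by (simp add: power2_eq_square flip: abs_mult)
  qed
  also have "\<dots> = (ell1_norm u)\<^sup>2"
    by (simp add: suminf_mult s power2_eq_square flip: ell1_norm_def)
  finally show "(norm u)\<^sup>2 \<le> (ell1_norm u)\<^sup>2" .
qed (rule ell1_norm_nonneg[OF assms])

lemma proj_Compl_ell2: "proj_ell2 A u + proj_ell2 (- A) u = u"
  by (rule ell2_eqI) (simp add: plus_ell2.rep_eq proj_ell2.rep_eq)

lemma proj_diff_ell2: "proj_ell2 A (u - v) = proj_ell2 A u - proj_ell2 A v"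
  by (rule ell2_eqI) (simp add: minus_ell2.rep_eq proj_ell2.rep_eq)

lemma ell1_norm_proj_finite:
  assumes "finite A"
  shows "ell1_norm (proj_ell2 A u) = (\<Sum>k\<in>A. \<bar>nth_ell2 u k\<bar>)"
  unfolding ell1_norm_def by (subst suminf_finite[of A]) (auto simp: assms proj_ell2.rep_eq)

section \<open>Injectivity on finitely many coordinates\<close>

text \<open>Orthogonal projection onto the span of a finite, possibly dependent family. The
  induction is Gram-Schmidt: \<open>y\<close> and the new vector are both first made orthogonal to
  the old ones.\<close>

lemma exists_orthogonal_remainder:
  fixes x :: "'i \<Rightarrow> 'a::real_inner"
  assumes "finite A"
  shows "\<exists>c. \<forall>k\<in>A. (y - (\<Sum>i\<in>A. c i *\<^sub>R x i)) \<bullet> x k = 0"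
  using assms
proof (induction A arbitrary: y)
  case (insert j A)
  obtain c where c: "\<And>k. k \<in> A \<Longrightarrow> (y - (\<Sum>i\<in>A. c i *\<^sub>R x i)) \<bullet> x k = 0"
    using insert.IH by blast
  obtain d where d: "\<And>k. k \<in> A \<Longrightarrow> (x j - (\<Sum>i\<in>A. d i *\<^sub>R x i)) \<bullet> x k = 0"
    using insert.IH by blast
  define y' where "y' = y - (\<Sum>i\<in>A. c i *\<^sub>R x i)"
  define x' where "x' = x j - (\<Sum>i\<in>A. d i *\<^sub>R x i)"
  \<comment> \<open>If \<open>x'\<close> is zero, the new vector already lies in the old span, and
    division by zero makes \<open>s\<close> zero.\<close>
  define s where "s = (y' \<bullet> x') / (x' \<bullet> x')"
  define c' where "c' i = (if i = j then s else c i - s * d i)" for i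
  have "(\<Sum>i\<in>A. c' i *\<^sub>R x i) = (\<Sum>i\<in>A. c i *\<^sub>R x i - s *\<^sub>R d i *\<^sub>R x i)"
    using insert.hyps by (intro sum.cong) (auto simp: c'_def algebra_simps)
  then have eq: "y - (\<Sum>i\<in>insert j A. c' i *\<^sub>R x i) = y' - s *\<^sub>R x'"
    using insert.hyps
    by (simp add: c'_def y'_def x'_def algebra_simps sum_subtractf scaleR_right.sum)
  have A: "(y' - s *\<^sub>R x') \<bullet> x k = 0" if "k \<in> A" for k
    using c[OF that] d[OF that] by (simp add: y'_def x'_def inner_diff_left)
  have "(y' - s *\<^sub>R x') \<bullet> x' = 0"
    by (cases "x' = 0") (simp_all add: s_def inner_diff_left)
  moreover have "x j = x' + (\<Sum>i\<in>A. d i *\<^sub>R x i)" by (simp add: x'_def)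
  ultimately have "(y' - s *\<^sub>R x') \<bullet> x j = 0"
    using A by (simp add: inner_add_right inner_sum_right)
  with A show ?case
    unfolding eq[symmetric] by (intro exI[of _ c']) auto
qed simp

text \<open>Finite dimension makes injectivity quantitative: removing from each column of
  \<open>K\<close> its projection onto the others leaves a nonzero vector, and the reciprocal
  lengths of these remainders add up to \<open>C\<close>.\<close>

lemma injective_lower_bound:
  fixes K :: "ell2 \<Rightarrow> 'b::real_inner"
  assumes "linear K" "finite A"
    and inj: "\<And>u. u \<in> ell1 \<Longrightarrow> K (proj_ell2 A u) = 0 \<Longrightarrow> proj_ell2 A u = 0"
  obtains C where "C \<ge> 0" "\<And>u. ell1_norm (proj_ell2 A u) \<le> C * norm (K (proj_ell2 A u))"
proof -
  interpret linear K by fact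
  define x where "x k = K (unit_ell2 k)" for k
  have "\<forall>j. \<exists>c. \<forall>k\<in>A - {j}. (x j - (\<Sum>i\<in>A - {j}. c i *\<^sub>R x i)) \<bullet> x k = 0"
    by (intro allI exists_orthogonal_remainder) (simp add: \<open>finite A\<close>)
  from choice[OF this] obtain c where
    c: "\<forall>j. \<forall>k\<in>A - {j}. (x j - (\<Sum>i\<in>A - {j}. c j i *\<^sub>R x i)) \<bullet> x k = 0" ..
  text \<open>\<open>z\<close> is biorthogonal to \<open>x\<close>, so pairing with \<open>z j\<close> reads off the \<open>j\<close>-th coordinate.\<close>
  define z where "z j = x j - (\<Sum>i\<in>A - {j}. c j i *\<^sub>R x i)" for j
  have z_nz: "z j \<noteq> 0" if "j \<in> A" for j
  proof
    assume "z j = 0"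
    \<comment> \<open>\<open>v\<close> is a preimage of \<open>z j\<close> supported on
      \<open>A\<close> with coordinate one at \<open>j\<close>, so injectivity is violated if
      \<open>z j\<close> vanishes.\<close>
    define v where "v = unit_ell2 j - (\<Sum>i\<in>A - {j}. c j i *\<^sub>R unit_ell2 i)"
    have nth_v: "nth_ell2 v k = (if k = j then 1 else if k \<in> A then - c j k else 0)" for k
      using \<open>finite A\<close>
      by (simp add: v_def minus_ell2.rep_eq nth_unit_combination unit_ell2.rep_eq)
    have "v \<in> ell1"
      unfolding ell1_def using \<open>finite A\<close> that
      by (auto simp: nth_v intro!: summable_finite[of A])
    moreover have proj: "proj_ell2 A v = v"
      using that by (intro ell2_eqI) (auto simp: proj_ell2.rep_eq nth_v)
    moreover have "K v = z j"
      by (simp add: v_def z_def x_def diff sum scaleR)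
    ultimately have "v = 0" using inj \<open>z j = 0\<close> by metis
    then have "nth_ell2 v j = 0" by (simp add: zero_ell2.rep_eq)
    then show False by (simp add: nth_v)
  qed
  have coord: "\<bar>nth_ell2 u j\<bar> \<le> 1 / norm (z j) * norm (K (proj_ell2 A u))" if "j \<in> A" for u j
  proof -
    have orth: "z j \<bullet> x k = 0" if "k \<in> A" "k \<noteq> j" for k
      using c that by (simp add: z_def)
    have "z j \<bullet> x j = z j \<bullet> z j"
    proof -
      have "z j \<bullet> (\<Sum>i\<in>A - {j}. c j i *\<^sub>R x i) = 0"
        unfolding inner_sum_right by (intro sum.neutral) (simp add: orth)
      then have "z j \<bullet> z j = z j \<bullet> x j"
        by (subst (2) z_def) (simp add: inner_diff_right)
      then show ?thesis by simp
    qed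
    moreover have "K (proj_ell2 A u) = (\<Sum>k\<in>A. nth_ell2 u k *\<^sub>R x k)"
      by (simp add: proj_ell2_finite \<open>finite A\<close> sum scaleR x_def)
    ultimately have "z j \<bullet> K (proj_ell2 A u) = nth_ell2 u j * (norm (z j))\<^sup>2"
      using orth \<open>finite A\<close> that
      by (simp add: inner_add_right inner_sum_right sum.remove[of A j] power2_norm_eq_inner)
    then have "\<bar>nth_ell2 u j\<bar> * (norm (z j))\<^sup>2 \<le> norm (z j) * norm (K (proj_ell2 A u))"
      using Cauchy_Schwarz_ineq2[of "z j" "K (proj_ell2 A u)"] by (simp add: abs_mult)
    then show ?thesis
      using z_nz[OF that] by (simp add: field_simps power2_eq_square)
  qed
  show thesis
  proof
    show "0 \<le> (\<Sum>j\<in>A. 1 / norm (z j))" by (intro sum_nonneg) auto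
    show "ell1_norm (proj_ell2 A u) \<le> (\<Sum>j\<in>A. 1 / norm (z j)) * norm (K (proj_ell2 A u))" for u
      unfolding ell1_norm_proj_finite[OF \<open>finite A\<close>] sum_distrib_right
      by (intro sum_mono coord)
  qed
qed

section \<open>The augmented Lagrangian iteration\<close>

lemma power2_norm_add_scaleR:
  fixes x y :: "'a::real_inner"
  shows "(norm (x + c *\<^sub>R y))\<^sup>2 = (norm x)\<^sup>2 + 2 * c * (x \<bullet> y) + c\<^sup>2 * (norm y)\<^sup>2"
  unfolding power2_norm_eq_inner
  by (simp add: inner_commute power2_eq_square algebra_simps)

text \<open>Finiteness of the objective at \<open>0\<close> puts the minimiser in
  \<open>ell1\<close>. The gradient of the quadratic part combines with \<open>q\<close> to the
  updated multiplier, so the first-order condition is a subgradient inequality for that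
  multiplier.\<close>

lemma augmented_lagrangian_step_ell1:
  fixes K :: "ell2 \<Rightarrow> 'b::real_inner"
  assumes "linear K"
    and min: "is_arg_min
      (\<lambda>v. ereal (t / 2 * (norm (K v - f))\<^sup>2) + ell1_functional v - ereal (q \<bullet> (K v - f)))
      (\<lambda>_. True) u"
  shows "u \<in> ell1"
    and "v \<in> ell1 \<Longrightarrow> ell1_norm u + (q + t *\<^sub>R (f - K u)) \<bullet> K (v - u) \<le> ell1_norm v"
proof -
  interpret linear K by fact
  let ?F = "\<lambda>v. ereal (t / 2 * (norm (K v - f))\<^sup>2) + ell1_functional v - ereal (q \<bullet> (K v - f))"
  have le: "?F u \<le> ?F v" for v
    using min by (auto simp: is_arg_min_def not_less)
  show u: "u \<in> ell1"
    using le[of 0] by (cases "u \<in> ell1") (auto simp: ell1_functional_def zero_in_ell1)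
  assume v: "v \<in> ell1"
  define d where "d = K (v - u)"
  define A where "A = ell1_norm v - ell1_norm u - (q + t *\<^sub>R (f - K u)) \<bullet> d"
  \<comment> \<open>The minimiser is compared with a point \<open>w\<close> on the segment towards
    \<open>v\<close>. Convexity and division by \<open>s\<close> leave a remainder of order
    \<open>s\<close>, which vanishes as \<open>s\<close> tends to zero from the right.\<close>
  have "0 \<le> A + s * (t / 2 * (norm d)\<^sup>2)" if s: "0 < s" "s \<le> 1" for s
  proof -
    define w where "w = (1 - s) *\<^sub>R u + s *\<^sub>R v"
    have w: "w \<in> ell1"
      unfolding w_def by (intro add_in_ell1 scaleR_in_ell1 u v)
    have "ell1_norm w \<le> (1 - s) * ell1_norm u + s * ell1_norm v"
      unfolding w_def using s
      by (intro order_trans[OF ell1_norm_add]) (simp_all add: scaleR_in_ell1 ell1_norm_scaleR u v)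
    moreover have "t / 2 * (norm (K u - f))\<^sup>2 + ell1_norm u - q \<bullet> (K u - f)
        \<le> t / 2 * (norm (K w - f))\<^sup>2 + ell1_norm w - q \<bullet> (K w - f)"
      using le[of w] by (simp add: ell1_functional_def u w)
    moreover have Kw: "K w - f = (K u - f) + s *\<^sub>R d"
      by (simp add: w_def d_def add diff scaleR algebra_simps)
    then have "t / 2 * (norm (K w - f))\<^sup>2 = t / 2 * (norm (K u - f))\<^sup>2
        + s * (t * ((K u - f) \<bullet> d)) + s * (s * (t / 2 * (norm d)\<^sup>2))"
      by (simp only: power2_norm_add_scaleR) (simp add: algebra_simps power2_eq_square)
    moreover have "q \<bullet> (K w - f) = q \<bullet> (K u - f) + s * (q \<bullet> d)"
      by (simp only: Kw inner_add_right inner_scaleR_right)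
    moreover have "A = ell1_norm v - ell1_norm u - q \<bullet> d + t * ((K u - f) \<bullet> d)"
      by (simp add: A_def inner_add_left inner_diff_left algebra_simps)
    then have "s * A = s * ell1_norm v - s * ell1_norm u - s * (q \<bullet> d) + s * (t * ((K u - f) \<bullet> d))"
      by (simp only: right_diff_distrib distrib_left)
    ultimately have "0 \<le> s * (A + s * (t / 2 * (norm d)\<^sup>2))"
      unfolding distrib_left left_diff_distrib mult_1 by linarith
    then show ?thesis using s by (simp add: zero_le_mult_iff)
  qed
  then have "\<forall>\<^sub>F s in at_right 0. 0 \<le> A + s * (t / 2 * (norm d)\<^sup>2)"
    unfolding eventually_at_right_field by (intro exI[of _ 1]) auto
  moreover have "((\<lambda>s. A + s * (t / 2 * (norm d)\<^sup>2)) \<longlongrightarrow> A + 0 * (t / 2 * (norm d)\<^sup>2)) (at_right 0)"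
    by (intro tendsto_intros)
  ultimately have "0 \<le> A"
    using tendsto_lowerbound by fastforce
  then show "ell1_norm u + (q + t *\<^sub>R (f - K u)) \<bullet> K (v - u) \<le> ell1_norm v"
    by (simp add: A_def d_def)
qed

text \<open>By positive homogeneity, testing at twice \<open>u\<close> and at \<open>0\<close> fixes
  the pairing from both sides; the subgradient inequality then becomes a bound free of
  \<open>u\<close>.\<close>

lemma ell1_subgradient:
  fixes K :: "ell2 \<Rightarrow> 'b::real_inner"
  assumes "linear K" and u: "u \<in> ell1"
    and sub: "\<And>v. v \<in> ell1 \<Longrightarrow> ell1_norm u + q \<bullet> K (v - u) \<le> ell1_norm v"
  shows "q \<bullet> K u = ell1_norm u"
    and "v \<in> ell1 \<Longrightarrow> q \<bullet> K v \<le> ell1_norm v"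
proof -
  interpret linear K by fact
  have "ell1_norm u + q \<bullet> K (2 *\<^sub>R u - u) \<le> 2 * ell1_norm u"
    using sub[OF scaleR_in_ell1[OF u, of 2]] by (simp add: ell1_norm_scaleR u)
  then have "q \<bullet> K u \<le> ell1_norm u"
    by (simp add: scaleR_2)
  moreover have "ell1_norm u \<le> q \<bullet> K u"
    using sub[OF zero_in_ell1] by (simp add: ell1_norm_0 neg)
  ultimately show eq: "q \<bullet> K u = ell1_norm u" by simp
  show "q \<bullet> K v \<le> ell1_norm v" if "v \<in> ell1"
    using sub[OF that] eq by (simp add: diff inner_diff_right)
qed

text \<open>
  For convex \<open>C\<close> the hypotheses say that \<open>p\<close> is the proximal point iteration for maximising
  \<open>f \<bullet> q\<close> over \<open>q \<in> C\<close>: \<open>f - s n\<close> lies in the normal cone of \<open>C\<close> at \<open>p n\<close>. The start \<open>p 0\<close> need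
  not lie in \<open>C\<close>.
\<close>

lemma dual_ascent_energy:
  fixes p s :: "nat \<Rightarrow> 'b::real_inner"
  assumes step: "\<And>n. n \<ge> 1 \<Longrightarrow> p n = p (n - 1) + \<tau> n *\<^sub>R s n"
    and pos: "\<And>n. n \<ge> 1 \<Longrightarrow> \<tau> n > 0"
    and mem: "\<And>n. n \<ge> 1 \<Longrightarrow> p n \<in> C"
    and normal: "\<And>n q. n \<ge> 1 \<Longrightarrow> q \<in> C \<Longrightarrow> (f - s n) \<bullet> (q - p n) \<le> 0"
    and "q \<in> C" and "n \<ge> 1"
  shows "2 * (\<Sum>k=1..n. \<tau> k) * (f \<bullet> (q - p n)) + (\<Sum>k=1..n. \<tau> k)\<^sup>2 * (norm (s n))\<^sup>2
           + (norm (q - p n))\<^sup>2 \<le> (norm (q - p 0))\<^sup>2"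
proof -
  \<comment> \<open>The distance from \<open>q\<close> to the previous iterate is expanded, and
    normality replaces \<open>s n\<close> by \<open>f\<close> in the cross term.\<close>
  have descent: "2 * \<tau> n * (f \<bullet> (q - p n)) + (\<tau> n)\<^sup>2 * (norm (s n))\<^sup>2 + (norm (q - p n))\<^sup>2
      \<le> (norm (q - p (n - 1)))\<^sup>2" if "n \<ge> 1" for n
  proof -
    have "q - p (n - 1) = (q - p n) + \<tau> n *\<^sub>R s n"
      using step[OF that] by simp
    then have "(norm (q - p (n - 1)))\<^sup>2
        = (norm (q - p n))\<^sup>2 + 2 * \<tau> n * (s n \<bullet> (q - p n)) + (\<tau> n)\<^sup>2 * (norm (s n))\<^sup>2"
      by (simp only: power2_norm_add_scaleR inner_commute[of "s n"])
    moreover have "\<tau> n * (f \<bullet> (q - p n)) \<le> \<tau> n * (s n \<bullet> (q - p n))"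
      using normal[OF that \<open>q \<in> C\<close>] pos[OF that] by (simp add: inner_diff_left)
    ultimately show ?thesis by simp
  qed
  show ?thesis
    using \<open>n \<ge> 1\<close>
  proof (induction n rule: nat_induct_at_least)
    case base
    show ?case using descent[of 1] by simp
  next
    case (Suc n)
    text \<open>The residuals \<open>norm (s n)\<close> decrease, because \<open>f - s n\<close> and \<open>f - s (n + 1)\<close> are normal to \<open>C\<close>
      at the consecutive points \<open>p n\<close> and \<open>p (n + 1)\<close>.\<close>
    define t where "t = (\<Sum>k=1..n. \<tau> k)"
    define T where "T = \<tau> (Suc n)"
    have "t \<ge> 0" unfolding t_def using pos by (intro sum_nonneg) (auto intro: less_imp_le)
    have "T > 0" unfolding T_def using pos by simp
    have p: "p (Suc n) = p n + T *\<^sub>R s (Suc n)"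
      using step[of "Suc n"] by (simp add: T_def)
    have 1: "(f - s n) \<bullet> (T *\<^sub>R s (Suc n)) \<le> 0"
      using normal[OF \<open>1 \<le> n\<close> mem[of "Suc n"]] p by simp
    have 2: "(f - s (Suc n)) \<bullet> (- (T *\<^sub>R s (Suc n))) \<le> 0"
      using normal[of "Suc n", OF _ mem[OF \<open>1 \<le> n\<close>]] p by simp
    from 1 \<open>T > 0\<close> have 1: "f \<bullet> s (Suc n) \<le> s n \<bullet> s (Suc n)"
      by (simp add: inner_diff_left mult_le_0_iff)
    from 2 \<open>T > 0\<close> have 2: "(norm (s (Suc n)))\<^sup>2 \<le> f \<bullet> s (Suc n)"
      by (simp add: inner_diff_left power2_norm_eq_inner zero_le_mult_iff)
    have "(norm (s (Suc n)))\<^sup>2 \<le> norm (s n) * norm (s (Suc n))"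
      using 1 2 norm_cauchy_schwarz[of "s n" "s (Suc n)"] by linarith
    then have "norm (s (Suc n)) \<le> norm (s n)"
      by (cases "s (Suc n) = 0") (auto simp: power2_eq_square)
    then have "t\<^sup>2 * (norm (s (Suc n)))\<^sup>2 \<le> t\<^sup>2 * (norm (s n))\<^sup>2"
      by (intro mult_left_mono power_mono) auto
    \<comment> \<open>By \<open>2\<close> the dual objective rises by at least \<open>T\<close>
      times the squared residual. Multiplied by \<open>2 * t\<close>, this gain pays for the mixed
      term in the square of \<open>t + T\<close>.\<close>
    moreover have "t * (f \<bullet> (q - p (Suc n))) \<le> t * (f \<bullet> (q - p n) - T * (norm (s (Suc n)))\<^sup>2)"
      using 2 \<open>T > 0\<close> \<open>t \<ge> 0\<close>
      by (intro mult_left_mono) (simp_all add: p inner_diff_right inner_add_right)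
    moreover have "2 * T * (f \<bullet> (q - p (Suc n))) + T\<^sup>2 * (norm (s (Suc n)))\<^sup>2 + (norm (q - p (Suc n)))\<^sup>2
      \<le> (norm (q - p n))\<^sup>2"
      using descent[of "Suc n"] by (simp add: T_def)
    moreover have "(\<Sum>k=1..Suc n. \<tau> k) = t + T" by (simp add: t_def T_def)
    ultimately show ?case
      using Suc.IH unfolding t_def[symmetric]
      by (simp only: power2_sum distrib_left distrib_right right_diff_distrib)
  qed
qed

text \<open>The bound on the elapsed time covers only indices whose residual is still large. It is
  therefore applied at \<open>m - 1\<close>, and the last step adds at most
  \<open>T * M\<close>.\<close>

lemma discrepancy_dual_bound:
  fixes p s :: "nat \<Rightarrow> 'b::real_inner"
  assumes step: "\<And>n. n \<ge> 1 \<Longrightarrow> p n = p (n - 1) + \<tau> n *\<^sub>R s n"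
    and pos: "\<And>n. n \<ge> 1 \<Longrightarrow> \<tau> n > 0"
    and mem: "\<And>n. n \<ge> 1 \<Longrightarrow> p n \<in> C"
    and normal: "\<And>n q. n \<ge> 1 \<Longrightarrow> q \<in> C \<Longrightarrow> (f - s n) \<bullet> (q - p n) \<le> 0"
    and q: "q \<in> C"
    and lower: "\<And>n. n \<ge> 1 \<Longrightarrow> - (d * norm (q - p n)) \<le> f \<bullet> (q - p n)"
    and tau_sum: "filterlim (\<lambda>n. \<Sum>k=1..n. \<tau> k) at_top sequentially"
    and tau_le: "\<And>n. n \<ge> 1 \<Longrightarrow> \<tau> n \<le> T"
    and d: "0 < d" "d \<le> M" and rho: "\<rho> > 1"
  defines "m \<equiv> LEAST n. n \<ge> 1 \<and> norm (s n) < \<rho> * d"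
  shows "m \<ge> 1" "norm (s m) < \<rho> * d"
    and "norm (q - p m) \<le> norm (q - p 0) + 2 * (norm (q - p 0) / sqrt (\<rho>\<^sup>2 - 1) + T * M)"
proof -
  define t where "t n = (\<Sum>k=1..n. \<tau> k)" for n
  define e where "e n = norm (q - p n)" for n
  have t_nonneg: "t n \<ge> 0" for n
    unfolding t_def using pos by (intro sum_nonneg) (auto intro: less_imp_le)
  have energy: "(t n)\<^sup>2 * (norm (s n))\<^sup>2 + (e n)\<^sup>2 \<le> (e 0)\<^sup>2 + 2 * (t n * d) * e n" if "n \<ge> 1" for n
  proof -
    have "2 * t n * (f \<bullet> (q - p n)) + (t n)\<^sup>2 * (norm (s n))\<^sup>2 + (e n)\<^sup>2 \<le> (e 0)\<^sup>2"
      using dual_ascent_energy[where p = p and s = s and C = C and f = f and q = q, OF step pos mem normal q that] by (simp add: t_def e_def)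
    moreover have "t n * - (d * e n) \<le> t n * (f \<bullet> (q - p n))"
      using lower[OF that] t_nonneg by (intro mult_left_mono) (auto simp: e_def)
    ultimately show ?thesis by (simp add: algebra_simps)
  qed
  have rho2: "\<rho>\<^sup>2 - 1 > 0" using rho by (simp add: power2_eq_square less_1_mult)
  have early: "t n * d \<le> e 0 / sqrt (\<rho>\<^sup>2 - 1)" if n: "n \<ge> 1" and large: "\<not> norm (s n) < \<rho> * d" for n
  proof -
    \<comment> \<open>This square absorbs the error term \<open>2 * (t n * d) * e n\<close> of the
      energy. A residual of at least \<open>\<rho> * d\<close> then leaves the positive factor
      \<rho> squared minus one.\<close>
    have "0 \<le> (e n - t n * d)\<^sup>2" by simp
    then have "(t n)\<^sup>2 * (norm (s n))\<^sup>2 \<le> (e 0)\<^sup>2 + (t n * d)\<^sup>2"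
      using energy[OF n] unfolding power2_diff by (simp add: algebra_simps)
    moreover have "(t n)\<^sup>2 * (\<rho> * d)\<^sup>2 \<le> (t n)\<^sup>2 * (norm (s n))\<^sup>2"
      using large d rho by (intro mult_left_mono power_mono) auto
    ultimately have "(t n * d)\<^sup>2 * (\<rho>\<^sup>2 - 1) \<le> (e 0)\<^sup>2"
      by (simp add: algebra_simps)
    also have "(t n * d)\<^sup>2 * (\<rho>\<^sup>2 - 1) = (t n * d * sqrt (\<rho>\<^sup>2 - 1))\<^sup>2"
      using rho2 by (simp add: power_mult_distrib)
    finally have "t n * d * sqrt (\<rho>\<^sup>2 - 1) \<le> e 0"
      by (rule power2_le_imp_le) (simp add: e_def)
    then show ?thesis using rho2 by (simp add: field_simps)
  qed
  \<comment> \<open>If no residual were small, \<open>early\<close> would bound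
    \<open>t n * d\<close> for all \<open>n \<ge> 1\<close>, against divergence of the step sums.
    Existence gives \<open>LEAST\<close> its meaning.\<close>
  have "\<exists>n. n \<ge> 1 \<and> norm (s n) < \<rho> * d"
  proof -
    have "\<forall>\<^sub>F n in sequentially. t n > e 0 / sqrt (\<rho>\<^sup>2 - 1) / d"
      using tau_sum unfolding t_def by (rule filterlim_at_top_dense[THEN iffD1, rule_format])
    from eventually_happens'[OF sequentially_bot eventually_conj[OF this eventually_ge_at_top[of 1]]]
    obtain n where "n \<ge> 1" "t n > e 0 / sqrt (\<rho>\<^sup>2 - 1) / d" by blast
    moreover from this d have "\<not> t n * d \<le> e 0 / sqrt (\<rho>\<^sup>2 - 1)"
      by (simp only: pos_divide_less_eq not_le)
    ultimately show ?thesis using early by blast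
  qed
  then have m_prop: "m \<ge> 1 \<and> norm (s m) < \<rho> * d"
    unfolding m_def by (rule LeastI_ex)
  then show m: "m \<ge> 1" and "norm (s m) < \<rho> * d" by auto
  have "T \<ge> 0" using pos[of 1] tau_le[of 1] by simp
  \<comment> \<open>\<open>early\<close> starts at index one, so \<open>m = 1\<close> is separate:
    there the sum up to \<open>m - 1\<close> is empty.\<close>
  have "t (m - 1) * d \<le> e 0 / sqrt (\<rho>\<^sup>2 - 1)"
  proof (cases "m = 1")
    case True
    then show ?thesis using rho2 by (simp add: t_def e_def)
  next
    case False
    with m have "m - 1 \<ge> 1" "m - 1 < m" by auto
    with not_less_Least[of "m - 1" "\<lambda>n. n \<ge> 1 \<and> norm (s n) < \<rho> * d"]
    show ?thesis by (intro early) (auto simp: m_def)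
  qed
  moreover have "\<tau> m * d \<le> T * M"
    using tau_le[OF m] d \<open>T \<ge> 0\<close> by (intro mult_mono) auto
  moreover have "t m = t (m - 1) + \<tau> m"
    using m by (cases m) (simp_all add: t_def)
  ultimately have tm: "t m * d \<le> e 0 / sqrt (\<rho>\<^sup>2 - 1) + T * M"
    by (simp add: distrib_right)
  \<comment> \<open>Without its residual term the energy is a quadratic inequality in
    \<open>e m\<close>, which a larger \<open>e m\<close> would violate.\<close>
  have "e m \<le> e 0 + 2 * (t m * d)"
  proof (rule ccontr)
    assume less: "\<not> e m \<le> e 0 + 2 * (t m * d)"
    have nn: "0 \<le> t m * d" "0 \<le> e 0" using t_nonneg d by (auto simp: e_def)
    have "(e 0 + 2 * (t m * d)) * e m < e m * e m"
      using less nn by (intro mult_strict_right_mono) auto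
    moreover have "e 0 * e 0 \<le> e 0 * e m"
      using less nn by (intro mult_left_mono) auto
    moreover have "(e m)\<^sup>2 \<le> (e 0)\<^sup>2 + 2 * (t m * d) * e m"
      using energy[OF m] by (smt (verit) mult_nonneg_nonneg zero_le_power2)
    ultimately show False by (simp add: power2_eq_square algebra_simps)
  qed
  with tm show "norm (q - p m) \<le> norm (q - p 0) + 2 * (norm (q - p 0) / sqrt (\<rho>\<^sup>2 - 1) + T * M)"
    by (simp add: e_def)
qed

section \<open>The convergence rate\<close>

text \<open>The comparison is termwise: the summands of the gap are nonnegative on \<open>A\<close>
  and at least \<open>1 - \<theta>\<close> times the absolute coordinate off
  \<open>A\<close>.\<close>

lemma ell1_gap:
  assumes u: "u \<in> ell1"
    and on: "\<And>k. k \<in> A \<Longrightarrow> \<bar>nth_ell2 \<xi> k\<bar> \<le> 1"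
    and off: "\<And>k. k \<notin> A \<Longrightarrow> \<bar>nth_ell2 \<xi> k\<bar> \<le> \<theta>"
  shows "(1 - \<theta>) * ell1_norm (proj_ell2 (- A) u) \<le> ell1_norm u - \<xi> \<bullet> u"
proof -
  let ?v = "proj_ell2 (- A) u"
  have s: "summable (\<lambda>k. \<bar>nth_ell2 u k\<bar>)" "summable (\<lambda>k. \<bar>nth_ell2 ?v k\<bar>)"
    using u proj_in_ell1[OF u] by (auto simp: ell1_def)
  have i: "summable (\<lambda>k. nth_ell2 \<xi> k * nth_ell2 u k)"
    by (intro summable_mult_of_squares summable_ell2_square)
  have "(\<Sum>k. (1 - \<theta>) * \<bar>nth_ell2 ?v k\<bar>) \<le> (\<Sum>k. \<bar>nth_ell2 u k\<bar> - nth_ell2 \<xi> k * nth_ell2 u k)"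
  proof (intro suminf_le summable_mult summable_diff s i)
    fix k
    have "nth_ell2 \<xi> k * nth_ell2 u k \<le> \<bar>nth_ell2 \<xi> k\<bar> * \<bar>nth_ell2 u k\<bar>"
      by (simp flip: abs_mult)
    also have "\<dots> \<le> (if k \<in> A then 1 else \<theta>) * \<bar>nth_ell2 u k\<bar>"
      using on off by (intro mult_right_mono) auto
    finally show "(1 - \<theta>) * \<bar>nth_ell2 ?v k\<bar> \<le> \<bar>nth_ell2 u k\<bar> - nth_ell2 \<xi> k * nth_ell2 u k"
      by (auto simp: proj_ell2.rep_eq algebra_simps split: if_splits)
  qed
  then show ?thesis
    by (simp add: suminf_mult suminf_diff[symmetric] s i ell1_norm_def inner_ell2.rep_eq)
qed

text \<open>Square-summable sequences tend to zero. At level one this makes the active set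
  \<open>I\<close> finite.\<close>

lemma finite_ell2_level:
  assumes "c > 0" shows "finite {k. \<bar>nth_ell2 u k\<bar> \<ge> c}"
proof -
  have "(\<lambda>k. \<bar>nth_ell2 u k\<bar>) \<longlonglongrightarrow> 0"
    using summable_LIMSEQ_zero[OF summable_ell2_square[of u]] by (simp add: tendsto_rabs_zero_iff)
  then have "\<forall>\<^sub>F k in sequentially. \<bar>nth_ell2 u k\<bar> < c"
    using assms by (rule order_tendstoD(2))
  then show ?thesis
    by (simp add: eventually_cofinite not_less flip: cofinite_eq_sequentially)
qed

text \<open>Off \<open>I\<close> the gap controls the error. On \<open>I\<close> the residual does,
  up to what the part off \<open>I\<close> contributes to it through \<open>K\<close>.\<close>

lemma ell1_source_estimate:
  fixes K :: "ell2 \<Rightarrow> 'b::real_inner"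
  assumes K: "bounded_linear K"
    and u_dag: "u_dag \<in> ell1" "q \<bullet> K u_dag = ell1_norm u_dag"
    and theta: "(SUP k\<in>-I. \<bar>nth_ell2 (adjoint K q) k\<bar>) < 1"
    and I: "I = {k. \<bar>nth_ell2 (adjoint K q) k\<bar> = 1}"
    and inj: "\<And>u. u \<in> ell1 \<Longrightarrow> K (proj_ell2 I u) = 0 \<Longrightarrow> proj_ell2 I u = 0"
  obtains c where "c \<ge> 0"
    "\<And>u. u \<in> ell1 \<Longrightarrow>
       ell1_norm (u - u_dag) \<le> c * (norm (K (u - u_dag)) + (ell1_norm u - q \<bullet> K u))"
proof -
  interpret bounded_linear K by fact
  obtain B where B: "\<And>x. norm (K x) \<le> norm x * B" "B \<ge> 0"
    using nonneg_bounded by blast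
  define \<theta> where "\<theta> = (SUP k\<in>-I. \<bar>nth_ell2 (adjoint K q) k\<bar>)"
  have "\<theta> < 1" using theta by (simp add: \<theta>_def)
  \<comment> \<open>A real \<open>SUP\<close> bounds the members of a set only when the set is
    bounded above, here by the Hilbert norm.\<close>
  have "bdd_above ((\<lambda>k. \<bar>nth_ell2 (adjoint K q) k\<bar>) ` (- I))"
    by (intro bdd_aboveI2[of _ _ "norm (adjoint K q)"] abs_nth_le_norm_ell2)
  then have off: "\<bar>nth_ell2 (adjoint K q) k\<bar> \<le> \<theta>" if "k \<notin> I" for k
    unfolding \<theta>_def using that by (intro cSUP_upper) auto
  have gap: "(1 - \<theta>) * ell1_norm (proj_ell2 (- I) u) \<le> ell1_norm u - q \<bullet> K u" if "u \<in> ell1" for u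
    using ell1_gap[OF that, of I "adjoint K q" \<theta>] off by (simp add: adjoint_ell2[OF K] I)
  have "finite I"
    by (rule finite_subset[OF _ finite_ell2_level[of 1 "adjoint K q"]]) (auto simp: I)
  then obtain C where C: "C \<ge> 0" "\<And>u. ell1_norm (proj_ell2 I u) \<le> C * norm (K (proj_ell2 I u))"
    using injective_lower_bound[OF linear_axioms _ inj] by blast
  \<comment> \<open>The gap of \<open>u_dag\<close> is zero, so \<open>u_dag\<close> vanishes off
    \<open>I\<close>, where \<open>u - u_dag\<close> then agrees with \<open>u\<close>.\<close>
  have "ell1_norm (proj_ell2 (- I) u_dag) \<le> 0"
    using gap[OF u_dag(1)] \<open>\<theta> < 1\<close> by (simp add: u_dag(2) mult_le_0_iff)
  then have support: "proj_ell2 (- I) u_dag = 0"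
    using norm_le_ell1_norm[OF proj_in_ell1[OF u_dag(1)]] by (metis norm_le_zero_iff order_trans)
  \<comment> \<open>The part off \<open>I\<close> enters once directly and once through
    \<open>K\<close> with factor \<open>C * B\<close>; dividing by \<open>1 - \<theta>\<close>
    expresses both by the gap.\<close>
  define E where "E = (C * B + 1) / (1 - \<theta>)"
  have "E \<ge> 0" using C B \<open>\<theta> < 1\<close> by (simp add: E_def)
  have bound: "ell1_norm (u - u_dag) \<le> (C + E) * (norm (K (u - u_dag)) + (ell1_norm u - q \<bullet> K u))"
    if u: "u \<in> ell1" for u
  proof -
    define w where "w = u - u_dag"
    define D where "D = ell1_norm u - q \<bullet> K u"
    define N where "N = ell1_norm (proj_ell2 (- I) w)"
    have w: "w \<in> ell1" unfolding w_def by (rule diff_in_ell1[OF u u_dag(1)])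
    have "N \<ge> 0" unfolding N_def by (intro ell1_norm_nonneg proj_in_ell1 w)
    have "(1 - \<theta>) * N \<le> D"
      using gap[OF u] by (simp add: N_def w_def D_def proj_diff_ell2 support)
    then have N: "N \<le> D / (1 - \<theta>)"
      using \<open>\<theta> < 1\<close> by (simp add: pos_le_divide_eq mult.commute)
    with \<open>N \<ge> 0\<close> \<open>\<theta> < 1\<close> have "D \<ge> 0"
      by (metis diff_gt_0_iff_gt order_trans zero_le_divide_iff not_less)
    have "norm (K (proj_ell2 I w)) \<le> norm (K w) + norm (K (proj_ell2 (- I) w))"
      using norm_triangle_ineq4[of "K w" "K (proj_ell2 (- I) w)"] add[of "proj_ell2 I w" "proj_ell2 (- I) w"]
      by (simp add: proj_Compl_ell2)
    also have "norm (K (proj_ell2 (- I) w)) \<le> N * B"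
      using B norm_le_ell1_norm[OF proj_in_ell1[OF w], of "- I"] unfolding N_def
      by (meson mult_right_mono order_trans)
    finally have "ell1_norm (proj_ell2 I w) \<le> C * (norm (K w) + N * B)"
      using C by (meson add_left_mono mult_left_mono order_trans)
    moreover have "ell1_norm w \<le> ell1_norm (proj_ell2 I w) + N"
      unfolding N_def using ell1_norm_add[OF proj_in_ell1[OF w] proj_in_ell1[OF w]]
      by (metis proj_Compl_ell2)
    ultimately have "ell1_norm w \<le> C * norm (K w) + (C * B + 1) * N"
      by (simp add: algebra_simps)
    also have "\<dots> \<le> C * norm (K w) + (C * B + 1) * (D / (1 - \<theta>))"
      using N C B by (intro add_left_mono mult_left_mono) auto
    also have "\<dots> = C * norm (K w) + E * D" by (simp add: E_def)
    also have "\<dots> \<le> (C + E) * (norm (K w) + D)"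
      using C \<open>D \<ge> 0\<close> \<open>E \<ge> 0\<close> by (simp add: algebra_simps)
    finally show ?thesis by (simp add: w_def D_def)
  qed
  show thesis
    by (rule that[of "C + E"]) (use bound C \<open>E \<ge> 0\<close> in auto)
qed

text \<open>\<open>R\<close> may be any selection of minimisers. Membership in \<open>ell1\<close>
  is asserted as well, because \<open>ell1_norm\<close> carries meaning only there.\<close>

theorem theorem6p6:
  fixes K :: "ell2 \<Rightarrow> 'h::{real_inner, complete_space, second_countable_topology}"
    and g p0 p_dag :: 'h
    and u_dag \<xi> :: ell2
    and I :: "nat set"
    and \<tau> :: "nat \<Rightarrow> real"
    and R :: "nat \<Rightarrow> 'h \<Rightarrow> ell2"
    and p :: "nat \<Rightarrow> 'h \<Rightarrow> 'h"
    and \<rho> :: real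
    and \<delta> :: "nat \<Rightarrow> real"
    and gs :: "nat \<Rightarrow> 'h"
  assumes K: "bounded_linear K"
    and attainable: "\<exists>u. K u = g \<and> ell1_functional u < \<infinity>"
    and tau_pos: "\<And>n. n \<ge> 1 \<Longrightarrow> \<tau> n > 0"
    and tau_sum: "filterlim (\<lambda>n. \<Sum>k=1..n. \<tau> k) at_top sequentially"
    and tau_bdd: "bdd_above (\<tau> ` {1..})"
    and iterates: "\<And>f. augmented_lagrangian K ell1_functional \<tau> p0 f (\<lambda>n. R n f) (\<lambda>n. p n f)"
    and u_dag: "is_arg_min ell1_functional (\<lambda>u. K u = g) u_dag"
    and source: "adjoint K p_dag \<in> subdifferential ell1_functional u_dag"
    and xi: "\<xi> = adjoint K p_dag"
    and I: "I = {k. \<bar>nth_ell2 \<xi> k\<bar> = 1}"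
    and theta: "(SUP k\<in>-I. \<bar>nth_ell2 \<xi> k\<bar>) < 1"
    and inj: "\<And>u v. u \<in> ell1 \<Longrightarrow> v \<in> ell1 \<Longrightarrow> proj_ell2 I u \<noteq> proj_ell2 I v \<Longrightarrow>
                K (proj_ell2 I u) \<noteq> K (proj_ell2 I v)"
    and rho: "\<rho> > 1"
    and delta_pos: "\<And>k. \<delta> k > 0"
    and delta_lim: "\<delta> \<longlonglongrightarrow> 0"
    and data: "\<And>k. norm (gs k - g) \<le> \<delta> k"
  shows "(\<forall>k. R (morozov K R \<rho> (\<delta> k) (gs k)) (gs k) - u_dag \<in> ell1) \<and>
         (\<lambda>k. ell1_norm (R (morozov K R \<rho> (\<delta> k) (gs k)) (gs k) - u_dag)) \<in> O(\<delta>)"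
proof -

  \<comment> \<open>Attainability and the source condition\<close>
  interpret bounded_linear K by fact
  \<comment> \<open>\<open>C\<close> is the dual feasible set: the preimage under the adjoint of
    \<open>K\<close> of the unit ball for the supremum norm.\<close>
  define C where "C = {q. \<forall>v\<in>ell1. q \<bullet> K v \<le> ell1_norm v}"
  obtain u0 where "K u0 = g" "ell1_functional u0 < \<infinity>" using attainable by blast
  with u_dag have u_dag_ell1: "u_dag \<in> ell1" and Ku_dag: "K u_dag = g"
    by (auto simp: is_arg_min_def ell1_functional_def not_less split: if_splits)
  have sub: "ell1_norm u_dag + p_dag \<bullet> K (v - u_dag) \<le> ell1_norm v" if "v \<in> ell1" for v
    using source that u_dag_ell1
    by (auto simp: subdifferential_def adjoint_ell2[OF K] ell1_functional_def dest!: spec[of _ v])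
  have p_dag_g: "p_dag \<bullet> g = ell1_norm u_dag"
    using ell1_subgradient(1)[OF linear_axioms u_dag_ell1 sub] by (simp add: Ku_dag)
  have p_dag_C: "p_dag \<in> C"
    using ell1_subgradient(2)[OF linear_axioms u_dag_ell1 sub] by (simp add: C_def)

  \<comment> \<open>The iterates as a dual proximal point method\<close>
  have p_0: "p 0 f = p0" for f
    using iterates by (simp add: augmented_lagrangian_def)
  have step: "p n f = p (n - 1) f + \<tau> n *\<^sub>R (f - K (R n f))" if "n \<ge> 1" for n f
    using iterates that by (simp add: augmented_lagrangian_def)
  have R_min: "is_arg_min (\<lambda>v. ereal (\<tau> n / 2 * (norm (K v - f))\<^sup>2) + ell1_functional v
      - ereal (p (n - 1) f \<bullet> (K v - f))) (\<lambda>_. True) (R n f)" if "n \<ge> 1" for n f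
    using iterates that by (simp add: augmented_lagrangian_def)
  have R_ell1: "R n f \<in> ell1" if "n \<ge> 1" for n f
    by (rule augmented_lagrangian_step_ell1(1)[OF linear_axioms R_min[OF that]])
  have R_sub: "ell1_norm (R n f) + p n f \<bullet> K (v - R n f) \<le> ell1_norm v"
    if "n \<ge> 1" "v \<in> ell1" for n f v
    using augmented_lagrangian_step_ell1(2)[OF linear_axioms R_min that(2)] that(1)
    by (simp add: step)
  have p_R: "p n f \<bullet> K (R n f) = ell1_norm (R n f)" if "n \<ge> 1" for n f
    by (rule ell1_subgradient(1)[OF linear_axioms R_ell1[OF that] R_sub[OF that]])
  have p_C: "p n f \<in> C" if "n \<ge> 1" for n f
    using ell1_subgradient(2)[OF linear_axioms R_ell1[OF that] R_sub[OF that]]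
    by (simp add: C_def)
  \<comment> \<open>The normal direction is \<open>K (R n f)\<close>: its pairing with elements of
    \<open>C\<close> is at most \<open>ell1_norm (R n f)\<close>, a value attained at
    \<open>p n f\<close>.\<close>
  have normal: "(f - (f - K (R n f))) \<bullet> (q - p n f) \<le> 0" if "n \<ge> 1" "q \<in> C" for n f q
    using that p_R[of n f] R_ell1[of n f] by (simp add: C_def inner_diff_right inner_commute)
  \<comment> \<open>On \<open>C\<close> the pairing with \<open>g = K u_dag\<close> is at most
    \<open>ell1_norm u_dag\<close>, which \<open>p_dag\<close> attains.\<close>
  have dual_opt: "0 \<le> g \<bullet> (p_dag - p n f)" if "n \<ge> 1" for n f
    using p_C[OF that, of f] u_dag_ell1 p_dag_g Ku_dag
    by (auto simp: C_def inner_diff_right inner_commute)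

  \<comment> \<open>Uniform bounds at the stopping index\<close>
  obtain T where T: "\<And>n. n \<ge> 1 \<Longrightarrow> \<tau> n \<le> T"
    using tau_bdd by (auto simp: bdd_above_def)
  have "Bseq \<delta>" using delta_lim by (intro convergent_imp_Bseq convergentI)
  then obtain M where "\<And>k. norm (\<delta> k) \<le> M" by (auto simp: Bseq_def)
  then have M: "\<delta> k \<le> M" for k by (metis abs_ge_self order_trans real_norm_def)
  \<comment> \<open>\<open>E\<close> depends neither on \<open>k\<close> nor on the data: every run
    starts at \<open>p0\<close>, and \<open>M\<close> bounds all noise levels.\<close>
  define E where "E = norm (p_dag - p0) + 2 * (norm (p_dag - p0) / sqrt (\<rho>\<^sup>2 - 1) + T * M)"
  have stop: "\<Gamma> \<ge> 1 \<and> norm (K (R \<Gamma> f) - f) < \<rho> * d \<and> norm (p_dag - p \<Gamma> f) \<le> E"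
    if d: "0 < d" "d \<le> M" "norm (f - g) \<le> d" and \<Gamma>: "\<Gamma> = morozov K R \<rho> d f" for f d \<Gamma>
  proof -
    \<comment> \<open>The data split into \<open>g\<close>, whose pairing is nonnegative by
      \<open>dual_opt\<close>, and noise, handled by Cauchy-Schwarz.\<close>
    have lower: "- (d * norm (p_dag - p n f)) \<le> f \<bullet> (p_dag - p n f)" if "n \<ge> 1" for n
    proof -
      have "\<bar>(f - g) \<bullet> (p_dag - p n f)\<bar> \<le> norm (f - g) * norm (p_dag - p n f)"
        by (rule Cauchy_Schwarz_ineq2)
      also have "\<dots> \<le> d * norm (p_dag - p n f)" using d by (intro mult_right_mono) auto
      finally show ?thesis using dual_opt[OF that, of f] by (simp add: inner_diff_left)
    qed
    have "\<Gamma> = (LEAST n. n \<ge> 1 \<and> norm (f - K (R n f)) < \<rho> * d)"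
      unfolding \<Gamma> morozov_def by (simp add: norm_minus_commute)
    with discrepancy_dual_bound[where p = "\<lambda>n. p n f" and s = "\<lambda>n. f - K (R n f)" and C = C and f = f
        and q = p_dag, OF step tau_pos p_C normal p_dag_C lower tau_sum T d(1,2) rho]
    show ?thesis by (simp add: E_def p_0 norm_minus_commute)
  qed

  \<comment> \<open>From the dual bound to the rate\<close>
  have inj0: "proj_ell2 I u = 0" if "u \<in> ell1" "K (proj_ell2 I u) = 0" for u
  proof -
    have "proj_ell2 I 0 = 0" by (rule ell2_eqI) (simp add: proj_ell2.rep_eq zero_ell2.rep_eq)
    with inj[OF that(1) zero_in_ell1] that(2) show ?thesis by auto
  qed
  obtain c where c: "c \<ge> 0" "\<And>u. u \<in> ell1 \<Longrightarrow>
      ell1_norm (u - u_dag) \<le> c * (norm (K (u - u_dag)) + (ell1_norm u - p_dag \<bullet> K u))"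
    using ell1_source_estimate[OF K u_dag_ell1 _ _ _ inj0, of p_dag] theta p_dag_g
    unfolding Ku_dag xi I by blast
  have main: "R \<Gamma> f - u_dag \<in> ell1 \<and> ell1_norm (R \<Gamma> f - u_dag) \<le> c * ((\<rho> + 1) + E * (\<rho> + 1)) * d"
    if d: "0 < d" "d \<le> M" "norm (f - g) \<le> d" and \<Gamma>: "\<Gamma> = morozov K R \<rho> d f" for f d \<Gamma>
  proof -
    define u where "u = R \<Gamma> f"
    have stop: "\<Gamma> \<ge> 1" "norm (K u - f) < \<rho> * d" "norm (p_dag - p \<Gamma> f) \<le> E"
      using stop[OF that] by (auto simp: u_def)
    have u: "u \<in> ell1" unfolding u_def by (rule R_ell1[OF stop(1)])
    have res: "norm (K u - g) \<le> (\<rho> + 1) * d"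
      using norm_triangle_ineq[of "K u - f" "f - g"] stop(2) d by (simp add: algebra_simps)
    have "ell1_norm u - p_dag \<bullet> K u = (p \<Gamma> f - p_dag) \<bullet> K u"
      using p_R[OF stop(1)] by (simp add: u_def inner_diff_left)
    \<comment> \<open>By \<open>dual_opt\<close>, subtracting \<open>g\<close> does not decrease the
      pairing. The gap is thus at most a bounded dual error times a residual of order
      \<open>d\<close>.\<close>
    also have "\<dots> \<le> (p \<Gamma> f - p_dag) \<bullet> (K u - g)"
      using dual_opt[OF stop(1), of f] by (simp add: inner_diff_left inner_diff_right inner_commute)
    also have "\<dots> \<le> norm (p \<Gamma> f - p_dag) * norm (K u - g)"
      by (rule norm_cauchy_schwarz)
    also have "\<dots> \<le> E * ((\<rho> + 1) * d)"
      using stop(3) res norm_ge_zero[of "p_dag - p \<Gamma> f"]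
      by (intro mult_mono) (simp_all only: norm_minus_commute[of "p \<Gamma> f"], auto)
    finally have "norm (K (u - u_dag)) + (ell1_norm u - p_dag \<bullet> K u)
        \<le> (\<rho> + 1) * d + E * ((\<rho> + 1) * d)"
      using res by (simp add: diff Ku_dag)
    then have "ell1_norm (u - u_dag) \<le> c * ((\<rho> + 1) * d + E * ((\<rho> + 1) * d))"
      using c u by (meson mult_left_mono order_trans)
    with diff_in_ell1[OF u u_dag_ell1] show ?thesis
      by (simp add: u_def algebra_simps)
  qed
  show ?thesis
  proof (intro conjI allI bigoI[where c = "c * ((\<rho> + 1) + E * (\<rho> + 1))"] always_eventually)
    show mem: "R (morozov K R \<rho> (\<delta> k) (gs k)) (gs k) - u_dag \<in> ell1" for k
      using main[OF delta_pos M data refl] by blast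
    show "norm (ell1_norm (R (morozov K R \<rho> (\<delta> k) (gs k)) (gs k) - u_dag))
        \<le> c * ((\<rho> + 1) + E * (\<rho> + 1)) * norm (\<delta> k)" for k
      using main[OF delta_pos M data refl, of k] ell1_norm_nonneg[OF mem[of k]] delta_pos[of k] by simp
  qed
qed

end
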